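(* Let $M$ be a smooth manifold, let $h \in \Omega^2(M)$ be a non-degenerate $2$-form, put $H = dh$, and let $\mathbb{L}_h = \{(X, \iota_X h) \mid X \in \mathfrak{X}(M)\}$ be the graph of $h$, regarded as an $H$-twisted Dirac structure on $M$. Let $f \in C^\infty(M)$ and let $X_f$ be a vector field with $(X_f, df) \in \mathbb{L}_h$. Then the pair $(X_f, df)$ is $H$-admissible if and only if $\mathcal{L}_{X_f} h = 0$.
   Context: The graph $\mathbb{L}_h$ is a maximally isotropic sub-bundle of $TM \oplus T^*M$ for the pairing $\langle X \oplus \xi, Y \oplus \eta\rangle_+ = \frac12(\xi(Y) + \eta(X))$, and it is involutive under the $H$-twisted Courant bracket $$[X \oplus \xi, Y \oplus \eta]_H = [X,Y] \oplus \left(\mathcal{L}_X \eta - \mathcal{L}_Y \xi - \tfrac12 d(\iota_X \eta - \iota_Y \xi) - \iota_Y \iota_X H\right)$$ if and only if $dh - H = 0$; in that case it is an $H$-twisted Dirac structure. A pair $(X_f, df)$ in $\mathbb{L}_h$ is called $H$-admissible if $d(df) + \iota_{X_f}H = 0$, i.e. if $\iota_{X_f} H = 0$. Here $\mathcal{L}_{X}$ denotes the Lie derivative. *)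

theory Defs
  imports "HOL-Analysis.Analysis" "HOL-Library.Function_Algebras"
begin

section \<open>Smooth maps and smooth manifolds\<close>

primrec Ck_on :: "nat \<Rightarrow> 'e::real_normed_vector set \<Rightarrow> ('e \<Rightarrow> 'f::real_normed_vector) \<Rightarrow> bool" where
  "Ck_on 0 S f \<longleftrightarrow> continuous_on S f"
| "Ck_on (Suc k) S f \<longleftrightarrow>
     (\<forall>x\<in>S. f differentiable (at x)) \<and> (\<forall>v. Ck_on k S (\<lambda>x. frechet_derivative f (at x) v))"

text \<open>For open sets in finite-dimensional spaces this is the usual class of smooth maps.\<close>

definition smooth_on :: "'e::real_normed_vector set \<Rightarrow> ('e \<Rightarrow> 'f::real_normed_vector) \<Rightarrow> bool" where
  "smooth_on S f \<longleftrightarrow> (\<forall>k. Ck_on k S f)"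

type_synonym ('a, 'e) chart = "'a set \<times> ('a \<Rightarrow> 'e)"

definition chart_image :: "('a, 'e) chart \<Rightarrow> 'e set" where
  "chart_image c = snd c ` fst c"

definition chart_inv :: "('a, 'e) chart \<Rightarrow> 'e \<Rightarrow> 'a" where
  "chart_inv c = inv_into (fst c) (snd c)"

definition transition :: "('a, 'e) chart \<Rightarrow> ('a, 'e) chart \<Rightarrow> 'e \<Rightarrow> 'e" where
  "transition c c' = snd c' \<circ> chart_inv c"

text \<open>The model space is an arbitrary finite-dimensional inner product space rather than a type of
  class \<open>euclidean_space\<close>, because the latter excludes dimension 0. The atlas need not be maximal:
  it determines the smooth structure.\<close>

definition smooth_manifold :: "'a topology \<Rightarrow> ('a, 'e::real_inner) chart set \<Rightarrow> bool" where
  "smooth_manifold M A \<longleftrightarrow>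
     (\<exists>B :: 'e set. finite B \<and> span B = UNIV) \<and>
     Hausdorff_space M \<and> second_countable M \<and>
     (\<forall>c\<in>A. openin M (fst c) \<and> open (chart_image c) \<and>
        homeomorphic_map (subtopology M (fst c)) (top_of_set (chart_image c)) (snd c)) \<and>
     (\<Union>c\<in>A. fst c) = topspace M \<and>
     (\<forall>c\<in>A. \<forall>c'\<in>A. smooth_on (snd c ` (fst c \<inter> fst c')) (transition c c'))"

definition smooth_functions :: "('a, 'e::real_inner) chart set \<Rightarrow> ('a \<Rightarrow> real) set" where
  "smooth_functions A = {f. \<forall>c\<in>A. smooth_on (chart_image c) (f \<circ> chart_inv c)}"

section \<open>Vector fields and differential forms\<close>

text \<open>Vector fields and differential forms are given by their local representatives: one smooth
  field or form on the image of each chart of the atlas, the representatives being related by the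
  transition maps. A \<open>k\<close>-form is applied to the list of its \<open>k\<close> arguments. Representatives vanish
  where they carry no meaning (for charts not in the atlas, outside the chart image, and on lists
  of length other than \<open>k\<close>), so that equality of HOL functions is equality of fields and forms.\<close>

type_synonym ('a, 'e) vfield = "('a, 'e) chart \<Rightarrow> 'e \<Rightarrow> 'e"
type_synonym ('a, 'e) form = "('a, 'e) chart \<Rightarrow> 'e \<Rightarrow> 'e list \<Rightarrow> real"

definition in_chart :: "('a, 'e) chart set \<Rightarrow> ('a, 'e) chart \<Rightarrow> 'e \<Rightarrow> bool" where
  "in_chart A c x \<longleftrightarrow> c \<in> A \<and> x \<in> chart_image c"

definition vector_fields :: "('a, 'e::real_inner) chart set \<Rightarrow> ('a, 'e) vfield set" where
  "vector_fields A = {X.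
     (\<forall>c x. \<not> in_chart A c x \<longrightarrow> X c x = 0) \<and>
     (\<forall>c\<in>A. smooth_on (chart_image c) (X c)) \<and>
     (\<forall>c\<in>A. \<forall>c'\<in>A. \<forall>p \<in> fst c \<inter> fst c'.
        X c' (snd c' p) = frechet_derivative (transition c c') (at (snd c p)) (X c (snd c p)))}"

definition forms :: "('a, 'e::real_inner) chart set \<Rightarrow> nat \<Rightarrow> ('a, 'e) form set" where
  "forms A k = {\<omega>.
     (\<forall>c x vs. \<not> in_chart A c x \<or> length vs \<noteq> k \<longrightarrow> \<omega> c x vs = 0) \<and>
     (\<forall>c x vs. in_chart A c x \<and> length vs = k \<longrightarrow>
        (\<forall>i<k. linear (\<lambda>v. \<omega> c x (vs[i := v]))) \<and>
        (\<forall>i j. i < j \<and> j < k \<and> vs ! i = vs ! j \<longrightarrow> \<omega> c x vs = 0)) \<and>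
     (\<forall>c\<in>A. \<forall>vs. length vs = k \<longrightarrow> smooth_on (chart_image c) (\<lambda>x. \<omega> c x vs)) \<and>
     (\<forall>c\<in>A. \<forall>c'\<in>A. \<forall>p \<in> fst c \<inter> fst c'. \<forall>vs. length vs = k \<longrightarrow>
        \<omega> c (snd c p) vs =
        \<omega> c' (snd c' p) (map (frechet_derivative (transition c c') (at (snd c p))) vs))}"

definition nondegenerate :: "('a, 'e::real_inner) chart set \<Rightarrow> ('a, 'e) form \<Rightarrow> bool" where
  "nondegenerate A h \<longleftrightarrow>
     (\<forall>c x v. in_chart A c x \<and> (\<forall>w. h c x [v, w] = 0) \<longrightarrow> v = 0)"

definition function_form :: "('a, 'e::real_inner) chart set \<Rightarrow> ('a \<Rightarrow> real) \<Rightarrow> ('a, 'e) form" where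
  "function_form A f c x vs = (if in_chart A c x \<and> vs = [] then f (chart_inv c x) else 0)"

text \<open>In a chart,
  \<open>d\<omega>(v\<^sub>0,\<dots>,v\<^sub>k) = \<Sum>i\<le>k. (-1)\<^sup>i D(\<omega>(v\<^sub>0,\<dots>,v\<^sub>i\<^sub>-\<^sub>1,v\<^sub>i\<^sub>+\<^sub>1,\<dots>,v\<^sub>k)) v\<^sub>i\<close> for constant \<open>v\<^sub>0,\<dots>,v\<^sub>k\<close>.\<close>

definition ext_d :: "('a, 'e::real_inner) chart set \<Rightarrow> ('a, 'e) form \<Rightarrow> ('a, 'e) form" where
  "ext_d A \<omega> c x vs = (if in_chart A c x then
     (\<Sum>i<length vs. (-1) ^ i *
        frechet_derivative (\<lambda>y. \<omega> c y (take i vs @ drop (Suc i) vs)) (at x) (vs ! i)) else 0)"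

definition interior_product :: "('a, 'e) vfield \<Rightarrow> ('a, 'e) form \<Rightarrow> ('a, 'e) form" where
  "interior_product X \<omega> c x vs = \<omega> c x (X c x # vs)"

definition lie_bracket :: "('e::real_normed_vector \<Rightarrow> 'e) \<Rightarrow> ('e \<Rightarrow> 'e) \<Rightarrow> 'e \<Rightarrow> 'e" where
  "lie_bracket X Y x =
     frechet_derivative Y (at x) (X x) - frechet_derivative X (at x) (Y x)"

text \<open>The Leibniz rule
  \<open>(L\<^sub>X \<omega>)(Y\<^sub>1,\<dots>,Y\<^sub>k) = X(\<omega>(Y\<^sub>1,\<dots>,Y\<^sub>k)) - \<Sum>i. \<omega>(Y\<^sub>1,\<dots>,[X,Y\<^sub>i],\<dots>,Y\<^sub>k)\<close>,
  evaluated in a chart on constant fields \<open>Y\<^sub>i\<close>.\<close>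

definition lie_derivative ::
  "('a, 'e::real_inner) chart set \<Rightarrow> ('a, 'e) vfield \<Rightarrow> ('a, 'e) form \<Rightarrow> ('a, 'e) form" where
  "lie_derivative A X \<omega> c x vs = (if in_chart A c x then
     frechet_derivative (\<lambda>y. \<omega> c y vs) (at x) (X c x)
     - (\<Sum>i<length vs. \<omega> c x (vs[i := lie_bracket (X c) (\<lambda>_. vs ! i) x])) else 0)"

section \<open>The graph of a 2-form and admissible pairs\<close>

definition graph_of_form ::
  "('a, 'e::real_inner) chart set \<Rightarrow> ('a, 'e) form \<Rightarrow> (('a, 'e) vfield \<times> ('a, 'e) form) set" where
  "graph_of_form A h = {(X, interior_product X h) | X. X \<in> vector_fields A}"

definition H_admissible ::
  "('a, 'e::real_inner) chart set \<Rightarrow> (('a, 'e) vfield \<times> ('a, 'e) form) set \<Rightarrow> ('a, 'e) form \<Rightarrow>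
   ('a, 'e) vfield \<times> ('a, 'e) form \<Rightarrow> bool" where
  "H_admissible A L H = (\<lambda>(X, \<xi>). (X, \<xi>) \<in> L \<and> ext_d A \<xi> + interior_product X H = 0)"

end

theory Submission
  imports Defs
begin

text \<open>The admissibility condition is
  \<open>d(df) + \<iota>\<^sub>X H = 0\<close> with \<open>X = X\<^sub>f\<close> and \<open>H = dh\<close>. Membership of \<open>(X, df)\<close> in the graph of \<open>h\<close>
  says \<open>df = \<iota>\<^sub>X h\<close>, so the left-hand side is \<open>d(\<iota>\<^sub>X h) + \<iota>\<^sub>X dh\<close>, which is \<open>\<L>\<^sub>X h\<close> by Cartan's
  formula. The two vanishing conditions therefore concern one and the same form.

  The work lies in Cartan's formula for 2-forms, \<open>cartan_formula_two_form\<close>. In a chart, on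
  constant vectors \<open>v, w\<close>, the form \<open>\<iota>\<^sub>X dh\<close> differentiates \<open>h\<close> with the value of \<open>X\<close> held
  fixed at the point, whereas \<open>d(\<iota>\<^sub>X h)\<close> also differentiates \<open>X\<close>. By the product rule
  (\<open>frechet_derivative_linear_family\<close>) the derivatives of \<open>h\<close> along \<open>v\<close> and \<open>w\<close> cancel in the sum,
  leaving \<open>D(h(v,w)) X + h(DX v, w) - h(DX w, v)\<close>. Since \<open>[X,v] = - DX v\<close> for constant \<open>v\<close>, and
  \<open>h\<close> is skew, this is the Leibniz formula defining \<open>\<L>\<^sub>X h\<close>.\<close>

text \<open>The derivatives of a form are given only for constant arguments, and the model space carries
  no preferred basis. An orthogonal basis makes the coordinates of a varying argument
  inner products, hence differentiable along with it.\<close>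

lemma orthogonal_expansion:
  fixes C :: "'e::real_inner set"
  assumes "finite C" "span C = UNIV" "pairwise orthogonal C"
  shows "x = (\<Sum>b\<in>C. (x \<bullet> b / (b \<bullet> b)) *\<^sub>R b)"
proof -
  define z where "z = x - (\<Sum>b\<in>C. (x \<bullet> b / (b \<bullet> b)) *\<^sub>R b)"
  have "orthogonal z y" if y: "y \<in> C" for y
  proof -
    have "(\<Sum>b\<in>C. x \<bullet> b / (b \<bullet> b) * (b \<bullet> y)) = (\<Sum>b\<in>C. if b = y then x \<bullet> y else 0)"
    proof (rule sum.cong[OF refl])
      fix b assume "b \<in> C"
      show "x \<bullet> b / (b \<bullet> b) * (b \<bullet> y) = (if b = y then x \<bullet> y else 0)"
      proof (cases "b = y")
        case False
        then have "b \<bullet> y = 0"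
          using pairwiseD[OF assms(3) \<open>b \<in> C\<close> y] by (simp add: orthogonal_def)
        then show ?thesis using False by simp
      qed simp
    qed
    then show ?thesis
      using assms(1) y by (simp add: z_def orthogonal_def inner_diff_left inner_sum_left)
  qed
  then have "orthogonal z z"
    using orthogonal_to_span[of z C z] assms(2) by simp
  then show ?thesis
    by (simp add: z_def orthogonal_self)
qed

text \<open>The product rule for the pairing of a varying linear map with a varying vector. In
  finite dimension it suffices that \<open>g y v\<close> is differentiable in \<open>y\<close> for each fixed \<open>v\<close>: the
  expansion in a basis reduces \<open>g y (X y)\<close> to finitely many products of scalars and vectors.\<close>

lemma frechet_derivative_linear_family:
  fixes g :: "'d::real_normed_vector \<Rightarrow> 'e::real_inner \<Rightarrow> 'f::real_normed_vector"
  assumes fin: "\<exists>B :: 'e set. finite B \<and> span B = UNIV"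
    and lin: "\<And>y. linear (g y)"
    and g: "\<And>v. (\<lambda>y. g y v) differentiable (at x)"
    and X: "X differentiable (at x)"
  shows "frechet_derivative (\<lambda>y. g y (X y)) (at x) v =
    frechet_derivative (\<lambda>y. g y (X x)) (at x) v + g x (frechet_derivative X (at x) v)"
proof -
  obtain C :: "'e set" where C: "finite C" "span C = UNIV" "pairwise orthogonal C"
    using fin basis_orthogonal by metis
  define \<kappa> where "\<kappa> u b = u \<bullet> b / (b \<bullet> b)" for u b :: 'e
  have expand: "g y u = (\<Sum>b\<in>C. \<kappa> u b *\<^sub>R g y b)" for y u
  proof -
    have "g y u = g y (\<Sum>b\<in>C. \<kappa> u b *\<^sub>R b)"
      using orthogonal_expansion[OF C, of u] by (simp add: \<kappa>_def)
    then show ?thesis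
      by (simp add: linear_sum[OF lin] linear_scale[OF lin])
  qed
  let ?X' = "frechet_derivative X (at x)"
  let ?g' = "\<lambda>b. frechet_derivative (\<lambda>y. g y b) (at x)"
  have X': "(X has_derivative ?X') (at x)"
    using X frechet_derivative_works by blast
  have g': "((\<lambda>y. g y b) has_derivative ?g' b) (at x)" for b
    using g frechet_derivative_works by blast
  have \<kappa>': "((\<lambda>y. \<kappa> (X y) b) has_derivative (\<lambda>v. \<kappa> (?X' v) b)) (at x)" for b
    unfolding \<kappa>_def by (intro derivative_intros bounded_linear.has_derivative[OF _ X']
        bounded_linear_divide bounded_linear_compose[OF bounded_linear_divide] bounded_linear_inner_left)
  have "((\<lambda>y. g y (X y)) has_derivative
      (\<lambda>v. \<Sum>b\<in>C. \<kappa> (X x) b *\<^sub>R ?g' b v + \<kappa> (?X' v) b *\<^sub>R g x b)) (at x)"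
    unfolding expand[of _ "X _"] by (intro has_derivative_sum has_derivative_scaleR \<kappa>' g')
  then have 1: "frechet_derivative (\<lambda>y. g y (X y)) (at x) v =
      (\<Sum>b\<in>C. \<kappa> (X x) b *\<^sub>R ?g' b v) + g x (?X' v)"
    by (simp add: frechet_derivative_at[symmetric] sum.distrib expand[of x "?X' v"])
  have "((\<lambda>y. g y (X x)) has_derivative (\<lambda>v. \<Sum>b\<in>C. \<kappa> (X x) b *\<^sub>R ?g' b v)) (at x)"
    unfolding expand[of _ "X x"]
    by (intro has_derivative_sum bounded_linear.has_derivative[OF bounded_linear_scaleR_right] g')
  then show ?thesis
    using 1 by (simp add: frechet_derivative_at[symmetric])
qed

lemma smooth_on_imp_differentiable:
  assumes "smooth_on S f" "x \<in> S"
  shows "f differentiable (at x)"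
  using assms Ck_on.simps(2)[of 0 S f] unfolding smooth_on_def by blast

lemma form_eq_0:
  assumes "\<omega> \<in> forms A k" "\<not> in_chart A c x \<or> length vs \<noteq> k"
  shows "\<omega> c x vs = 0"
  using assms unfolding forms_def mem_Collect_eq by blast

text \<open>Linearity holds at every point, charts outside the atlas and points outside the chart image
  included, since representatives vanish there.\<close>

lemma form_linear:
  assumes \<omega>: "\<omega> \<in> forms A k" and "length vs = k" "i < k"
  shows "linear (\<lambda>u. \<omega> c x (vs[i := u]))"
proof (cases "in_chart A c x")
  case True
  then show ?thesis
    using assms unfolding forms_def mem_Collect_eq by blast
next
  case False
  then show ?thesis
    by (simp add: form_eq_0[OF \<omega>] linear_zero)
qed

lemma form_alternating:
  assumes "\<omega> \<in> forms A k" "length vs = k" "i < j" "j < k" "vs ! i = vs ! j"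
  shows "\<omega> c x vs = 0"
  using assms unfolding forms_def mem_Collect_eq by blast

lemma form_differentiable:
  assumes "\<omega> \<in> forms A k" "length vs = k" "in_chart A c x"
  shows "(\<lambda>y. \<omega> c y vs) differentiable (at x)"
proof -
  have "smooth_on (chart_image c) (\<lambda>y. \<omega> c y vs)"
    using assms unfolding forms_def in_chart_def mem_Collect_eq by blast
  then show ?thesis
    using assms(3) smooth_on_imp_differentiable by (auto simp: in_chart_def)
qed

lemma two_form_linear:
  assumes "h \<in> forms A 2"
  shows "linear (\<lambda>u. h c x [u, w])" "linear (\<lambda>u. h c x [w, u])"
  using form_linear[OF assms, of "[w, w]" 0] form_linear[OF assms, of "[w, w]" 1] by simp_all

lemma two_form_skew:
  assumes h: "h \<in> forms A 2"
  shows "h c x [v, w] = - h c x [w, v]"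
proof -
  have alt: "h c x [u, u] = 0" for u
    by (rule form_alternating[OF h, of _ 0 1]) simp_all
  have "h c x [v + w, v + w] = h c x [v, v] + h c x [v, w] + (h c x [w, v] + h c x [w, w])"
    by (simp add: linear_add[OF two_form_linear(1)[OF h]] linear_add[OF two_form_linear(2)[OF h]])
  then show ?thesis
    by (simp add: alt)
qed

lemma cartan_formula_two_form:
  fixes A :: "('a, 'e::real_inner) chart set"
  assumes fin: "\<exists>B :: 'e set. finite B \<and> span B = UNIV"
    and h: "h \<in> forms A 2"
    and X: "X \<in> vector_fields A"
  shows "ext_d A (interior_product X h) + interior_product X (ext_d A h) = lie_derivative A X h"
proof (intro ext)
  fix c x vs
  show "(ext_d A (interior_product X h) + interior_product X (ext_d A h)) c x vs
    = lie_derivative A X h c x vs"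
  proof (cases "in_chart A c x")
    case False
    then show ?thesis
      by (simp add: ext_d_def lie_derivative_def interior_product_def)
  next
    case chart: True
    then have c: "c \<in> A" "x \<in> chart_image c"
      by (simp_all add: in_chart_def)
    show ?thesis
    proof (cases "length vs = 2")
      case False
      (* Each term evaluates h, or differentiates it, on a list whose length is not 2. *)
      have "(\<lambda>y. h c y (X c y # take i vs @ drop (Suc i) vs)) = (\<lambda>_. 0)"
        if "i < length vs" for i
        using that False by (auto intro!: ext form_eq_0[OF h])
      then have "ext_d A (interior_product X h) c x vs = 0"
        by (simp add: ext_d_def interior_product_def)
      moreover have "(\<lambda>y. h c y (take i (X c x # vs) @ drop (Suc i) (X c x # vs))) = (\<lambda>_. 0)"
        if "i < Suc (length vs)" for i
        using that False by (intro ext form_eq_0[OF h]) simp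
      then have "interior_product X (ext_d A h) c x vs = 0"
        by (simp add: ext_d_def interior_product_def del: drop_Suc_Cons)
      moreover have "lie_derivative A X h c x vs = 0"
        using False by (simp add: lie_derivative_def form_eq_0[OF h])
      ultimately show ?thesis
        by simp
    next
      case True
      then obtain v w where vs: "vs = [v, w]"
        by (auto simp: numeral_2_eq_2 length_Suc_conv)
      have dX: "X c differentiable (at x)"
        using X c by (auto simp: vector_fields_def intro: smooth_on_imp_differentiable)
      have dh: "(\<lambda>y. h c y [a, b]) differentiable (at x)" for a b
        by (rule form_differentiable[OF h _ chart]) simp
      let ?X' = "frechet_derivative (X c) (at x)"
      have product_rule: "frechet_derivative (\<lambda>y. h c y [X c y, b]) (at x) u =
        frechet_derivative (\<lambda>y. h c y [X c x, b]) (at x) u + h c x [?X' u, b]" for b u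
        by (rule frechet_derivative_linear_family[OF fin two_form_linear(1)[OF h] dh dX])
      have bracket: "lie_bracket (X c) (\<lambda>_. u) x = - ?X' u" for u
        by (simp add: lie_bracket_def)
      have minus: "h c x [- a, b] = - h c x [a, b]" "h c x [a, - b] = - h c x [a, b]" for a b
        by (rule linear_neg[OF two_form_linear(1)[OF h]] linear_neg[OF two_form_linear(2)[OF h]])+
      have "(ext_d A (interior_product X h) + interior_product X (ext_d A h)) c x vs =
        frechet_derivative (\<lambda>y. h c y [v, w]) (at x) (X c x)
        + h c x [?X' v, w] - h c x [?X' w, v]"
        using chart
        by (simp add: vs ext_d_def interior_product_def product_rule lessThan_Suc numeral_2_eq_2)
      also have "\<dots> = lie_derivative A X h c x vs"
        using chart two_form_skew[OF h, of c x v "?X' w"]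
        by (simp add: vs lie_derivative_def bracket minus lessThan_Suc numeral_2_eq_2)
      finally show ?thesis .
    qed
  qed
qed

theorem proposition2p4:
  fixes M :: "'a topology"
    and A :: "('a, 'e::real_inner) chart set"
    and h H :: "('a, 'e) form"
    and f :: "'a \<Rightarrow> real"
    and X\<^sub>f :: "('a, 'e) vfield"
  defines "df \<equiv> ext_d A (function_form A f)"
  assumes "smooth_manifold M A"
    and "h \<in> forms A 2"
    and "nondegenerate A h"
    and "H = ext_d A h"
    and "f \<in> smooth_functions A"
    and "X\<^sub>f \<in> vector_fields A"
    and "(X\<^sub>f, df) \<in> graph_of_form A h"
  shows "H_admissible A (graph_of_form A h) H (X\<^sub>f, df) \<longleftrightarrow> lie_derivative A X\<^sub>f h = 0"
proof -
  have df: "df = interior_product X\<^sub>f h"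
    using assms(8) by (simp add: graph_of_form_def)
  have "\<exists>B :: 'e set. finite B \<and> span B = UNIV"
    using assms(2) by (simp add: smooth_manifold_def)
  then have "ext_d A df + interior_product X\<^sub>f H = lie_derivative A X\<^sub>f h"
    unfolding df assms(5) using assms(3,7) by (rule cartan_formula_two_form)
  then show ?thesis
    using assms(8) by (simp add: H_admissible_def)
qed

end
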